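(* Let $A\in\mathbb{R}_{\ge 0}^{m\times n}$ and let $P=\{x\in\mathbb{R}^n_{\ge 0}: Ax\le\mathbf 1\}$ be a polytope contained in $[0,1]^n$. For every $\varepsilon\in(0,1/2)$ there exists a polyhedral relaxation $Q$ of the integer hull $P_I$ of $P$ such that $Q$ is a $(1+\varepsilon)^t$-approximation of $P^{(t)}$ for every integer $t\ge 1$ (i.e. $P_I\subseteq Q\subseteq(1+\varepsilon)^tP^{(t)}$ for all integers $t\ge1$, with the same $Q$), and $Q$ has a linear extended formulation of size at most $$m+n^{(2/\varepsilon)\cdot\log n}.$$
   Context: $\mathbf 1$ is the all-ones vector, and $\log$ is the base-2 logarithm. $P_I=\operatorname{conv}(P\cap\mathbb{Z}^n)$ is the integer hull of $P$. A relaxation of $P_I$ is a set $Q$ with $P_I\subseteq Q$; it is polyhedral if $Q$ is a polyhedron. Gomory closure: for a polyhedron $P$, $P'$ is the intersection of $P$ with all half-spaces $\{x: c^\intercal x\le\lfloor\delta\rfloor\}$ over all $c\in\mathbb{Z}^n$, $\delta\in\mathbb{R}$ such that $c^\intercal x\le\delta$ is valid for $P$. Set $P^{(0)}=P$ and $P^{(t)}=(P^{(t-1)})'$. For $\alpha\ge1$, $\alpha S=\{\alpha x:x\in S\}$. A linear extended formulation of $Q$ is a system of linear equations and inequalities in variables $(x,y)\in\mathbb{R}^{n+\ell}$ (for some $\ell$) whose solution set projects onto $Q$ in the $x$-coordinates; its size here is the number of its inequalities (the usual convention for extended formulations obtained from communication protocols). *)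

theory Defs
  imports "HOL-Analysis.Analysis"
begin

definition integer_points :: "(real ^ 'n) set" where
  "integer_points = {x. \<forall>i. x $ i \<in> \<int>}"

definition integer_hull :: "(real ^ 'n) set \<Rightarrow> (real ^ 'n) set" where
  "integer_hull P = convex hull (P \<inter> integer_points)"

definition gomory_closure :: "(real ^ 'n) set \<Rightarrow> (real ^ 'n) set" where
  "gomory_closure P =
     P \<inter> \<Inter> {{x. c \<bullet> x \<le> of_int \<lfloor>\<delta>\<rfloor>} | c \<delta>.
              c \<in> integer_points \<and> (\<forall>x\<in>P. c \<bullet> x \<le> \<delta>)}"

text \<open>A triple \<open>(a, b, \<beta>)\<close> encodes the linear form
  \<open>a \<bullet> x + (\<Sum>j<l. b j * y j)\<close> together with a right-hand side \<open>\<beta>\<close>. The \<open>l\<close> extra variables are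
  indexed by naturals because \<open>l\<close> is existentially quantified; entries of \<open>b\<close> and \<open>y\<close> at
  positions \<open>\<ge> l\<close> are irrelevant.\<close>

type_synonym 'n constraint = "(real ^ 'n) \<times> (nat \<Rightarrow> real) \<times> real"

definition satisfies_eq :: "nat \<Rightarrow> 'n::finite constraint \<Rightarrow> real ^ 'n \<Rightarrow> (nat \<Rightarrow> real) \<Rightarrow> bool" where
  "satisfies_eq l = (\<lambda>(a, b, \<beta>) x y. a \<bullet> x + (\<Sum>j<l. b j * y j) = \<beta>)"

definition satisfies_ineq :: "nat \<Rightarrow> 'n::finite constraint \<Rightarrow> real ^ 'n \<Rightarrow> (nat \<Rightarrow> real) \<Rightarrow> bool" where
  "satisfies_ineq l = (\<lambda>(a, b, \<beta>) x y. a \<bullet> x + (\<Sum>j<l. b j * y j) \<le> \<beta>)"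

definition extended_formulation ::
  "nat \<Rightarrow> 'n::finite constraint list \<Rightarrow> 'n constraint list \<Rightarrow> (real ^ 'n) set \<Rightarrow> bool" where
  "extended_formulation l eqs ineqs Q \<longleftrightarrow>
     Q = {x. \<exists>y. (\<forall>e\<in>set eqs. satisfies_eq l e x y) \<and> (\<forall>e\<in>set ineqs. satisfies_ineq l e x y)}"

text \<open>Equations do not count towards the size.\<close>

definition has_extended_formulation_of_size :: "(real ^ 'n::finite) set \<Rightarrow> nat \<Rightarrow> bool" where
  "has_extended_formulation_of_size Q s \<longleftrightarrow>
     (\<exists>l eqs ineqs. extended_formulation l eqs ineqs Q \<and> length ineqs = s)"

end

theory Submission
  imports Defs
begin

text \<open>
  Let \<open>k\<close> be the largest integer below \<open>1 / \<epsilon>\<close>. Rounding a right-hand side \<open>\<delta>\<close> with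
  \<open>\<lfloor>\<delta>\<rfloor> \<ge> 1 / \<epsilon>\<close> changes it by a factor of at most \<open>1 + \<epsilon>\<close>. Hence a subset of \<open>P\<close> that
  satisfies every inequality \<open>c \<bullet> x \<le> d\<close> with nonnegative integral \<open>c\<close> and \<open>d \<le> k\<close> that is valid
  for \<open>P\<^sub>I\<close> loses only a factor \<open>1 + \<epsilon>\<close> per Gomory round; cuts with negative coefficients
  may be ignored because \<open>P\<close> is down-closed.

  These inequalities are enforced through a nonnegative factorization of the slacks
  \<open>d - c(S)\<close>, with \<open>S\<close> ranging over the feasible sets, obtained from a protocol that generalizes
  Yannakakis' protocol for cliques and stable sets. Alice holds \<open>(c, d)\<close>, Bob holds \<open>S\<close>, and \<open>W\<close> is
  the part of the ground set still in play. Call \<open>v\<close> blocked by \<open>T\<close> if \<open>T \<union> {v}\<close> is contained in no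
  feasible set, and let \<open>cl T\<close> be \<open>T\<close> together with the elements blocked by it. If \<open>cl T\<close> contains
  the support of \<open>c\<close> and at most half of \<open>W\<close>, Alice announces \<open>T\<close> and \<open>W\<close> shrinks to \<open>cl T\<close>; if
  \<open>T \<subseteq> S\<close> and \<open>cl T\<close> exceeds half of \<open>W\<close>, Bob announces \<open>T\<close>, \<open>W\<close> shrinks to \<open>W - cl T\<close>, and
  \<open>d\<close> drops by \<open>c(T)\<close>. Sets \<open>T\<close> of at most \<open>k\<close> elements suffice: if nobody can speak then the
  slack is positive, since \<open>c(S) = d > 0\<close> would make the intersection of \<open>S\<close> with the support of
  \<open>c\<close> an admissible \<open>T\<close>. So \<open>d\<close> can be decreased by one and the protocol restarted.
\<close>

subsection \<open>Nonnegative factorizations\<close>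

text \<open>The matrix \<open>M\<close> with rows \<open>A\<close> and columns \<open>B\<close> has
  nonnegative rank at most \<open>r\<close>. Index sets may be infinite, and entries elsewhere do
  not matter.\<close>

definition nonneg_fact :: "'a set \<Rightarrow> 'b set \<Rightarrow> ('a \<Rightarrow> 'b \<Rightarrow> real) \<Rightarrow> nat \<Rightarrow> bool" where
  "nonneg_fact A B M r \<longleftrightarrow>
     (\<exists>f g. (\<forall>l<r. (\<forall>a\<in>A. 0 \<le> f l a) \<and> (\<forall>b\<in>B. 0 \<le> g l b)) \<and>
        (\<forall>a\<in>A. \<forall>b\<in>B. M a b = (\<Sum>l<r. f l a * g l b)))"

lemma nonneg_factI:
  assumes "\<And>l a. l < r \<Longrightarrow> a \<in> A \<Longrightarrow> 0 \<le> f l a"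
    and "\<And>l b. l < r \<Longrightarrow> b \<in> B \<Longrightarrow> 0 \<le> g l b"
    and "\<And>a b. a \<in> A \<Longrightarrow> b \<in> B \<Longrightarrow> M a b = (\<Sum>l<r. f l a * g l b)"
  shows "nonneg_fact A B M r"
  unfolding nonneg_fact_def using assms by blast

lemma nonneg_fact_zero:
  assumes "\<And>a b. a \<in> A \<Longrightarrow> b \<in> B \<Longrightarrow> M a b = 0"
  shows "nonneg_fact A B M 0"
  by (rule nonneg_factI[where f = "\<lambda>_ _. 0" and g = "\<lambda>_ _. 0"]) (auto simp: assms)

lemma nonneg_fact_add:
  assumes "nonneg_fact A B M r" "nonneg_fact A B M' r'"
    and "\<And>a b. a \<in> A \<Longrightarrow> b \<in> B \<Longrightarrow> N a b = M a b + M' a b"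
  shows "nonneg_fact A B N (r + r')"
proof -
  obtain f g where fg: "\<And>l a. l < r \<Longrightarrow> a \<in> A \<Longrightarrow> 0 \<le> f l a" "\<And>l b. l < r \<Longrightarrow> b \<in> B \<Longrightarrow> 0 \<le> g l b"
    "\<And>a b. a \<in> A \<Longrightarrow> b \<in> B \<Longrightarrow> M a b = (\<Sum>l<r. f l a * g l b)"
    using assms(1) unfolding nonneg_fact_def by blast
  obtain f' g' where fg': "\<And>l a. l < r' \<Longrightarrow> a \<in> A \<Longrightarrow> 0 \<le> f' l a" "\<And>l b. l < r' \<Longrightarrow> b \<in> B \<Longrightarrow> 0 \<le> g' l b"
    "\<And>a b. a \<in> A \<Longrightarrow> b \<in> B \<Longrightarrow> M' a b = (\<Sum>l<r'. f' l a * g' l b)"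
    using assms(2) unfolding nonneg_fact_def by blast
  show ?thesis
  proof (rule nonneg_factI[where f = "\<lambda>l. if l < r then f l else f' (l - r)"
        and g = "\<lambda>l. if l < r then g l else g' (l - r)"])
    fix a b assume "a \<in> A" "b \<in> B"
    have split: "sum h {..<r + r'} = sum h {..<r} + (\<Sum>l<r'. h (r + l))" for h :: "nat \<Rightarrow> real"
      by (induction r') auto
    show "N a b = (\<Sum>l<r + r'. (if l < r then f l else f' (l - r)) a * (if l < r then g l else g' (l - r)) b)"
      using \<open>a \<in> A\<close> \<open>b \<in> B\<close> by (simp add: split assms(3) fg fg')
  qed (auto simp: fg fg')
qed

lemma nonneg_fact_reindex:
  assumes "nonneg_fact A' B' M' r" "h ` A \<subseteq> A'" "k ` B \<subseteq> B'"
    and "\<And>a b. a \<in> A \<Longrightarrow> b \<in> B \<Longrightarrow> M a b = M' (h a) (k b)"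
  shows "nonneg_fact A B M r"
proof -
  obtain f g where fg: "\<And>l a. l < r \<Longrightarrow> a \<in> A' \<Longrightarrow> 0 \<le> f l a" "\<And>l b. l < r \<Longrightarrow> b \<in> B' \<Longrightarrow> 0 \<le> g l b"
    "\<And>a b. a \<in> A' \<Longrightarrow> b \<in> B' \<Longrightarrow> M' a b = (\<Sum>l<r. f l a * g l b)"
    using assms(1) unfolding nonneg_fact_def by blast
  have "h a \<in> A'" if "a \<in> A" for a using that assms(2) by auto
  moreover have "k b \<in> B'" if "b \<in> B" for b using that assms(3) by auto
  ultimately show ?thesis
    by (intro nonneg_factI[where f = "\<lambda>l. f l \<circ> h" and g = "\<lambda>l. g l \<circ> k"])
      (simp_all add: fg assms(4))
qed

lemma nonneg_fact_mono:
  assumes "nonneg_fact A B M r" "r \<le> r'"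
  shows "nonneg_fact A B M r'"
proof -
  have "nonneg_fact A B (\<lambda>_ _. 0) (r' - r)"
    by (rule nonneg_factI[where f = "\<lambda>_ _. 0" and g = "\<lambda>_ _. 0"]) auto
  from nonneg_fact_add[OF assms(1) this, of M] assms(2) show ?thesis by simp
qed

lemma nonneg_fact_transpose:
  assumes "nonneg_fact A B M r"
  shows "nonneg_fact B A (\<lambda>b a. M a b) r"
proof -
  obtain f g where fg: "\<And>l a. l < r \<Longrightarrow> a \<in> A \<Longrightarrow> 0 \<le> f l a" "\<And>l b. l < r \<Longrightarrow> b \<in> B \<Longrightarrow> 0 \<le> g l b"
    "\<And>a b. a \<in> A \<Longrightarrow> b \<in> B \<Longrightarrow> M a b = (\<Sum>l<r. f l a * g l b)"
    using assms unfolding nonneg_fact_def by blast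
  show ?thesis
    by (rule nonneg_factI[where f = g and g = f]) (simp_all add: fg mult.commute)
qed

text \<open>Factors of each block are extended by zero to the other rows, so the ranks of stacked
  blocks add up. This accounts for Alice's announcements, the transposed version for Bob's.\<close>

lemma nonneg_fact_Un_left:
  assumes "nonneg_fact A B M r" "nonneg_fact A' B M r'"
  shows "nonneg_fact (A \<union> A') B M (r + r')"
proof -
  have ext: "nonneg_fact (A \<union> A') B (\<lambda>a b. if a \<in> X then M a b else 0) s"
    if fact: "nonneg_fact X B M s" for X s
  proof -
    obtain f g where fg: "\<And>l a. l < s \<Longrightarrow> a \<in> X \<Longrightarrow> 0 \<le> f l a" "\<And>l b. l < s \<Longrightarrow> b \<in> B \<Longrightarrow> 0 \<le> g l b"
      "\<And>a b. a \<in> X \<Longrightarrow> b \<in> B \<Longrightarrow> M a b = (\<Sum>l<s. f l a * g l b)"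
      using fact unfolding nonneg_fact_def by blast
    show ?thesis
      by (rule nonneg_factI[where f = "\<lambda>l a. if a \<in> X then f l a else 0" and g = g])
        (auto simp: fg)
  qed
  \<comment> \<open>Rows lying in both blocks stay in the first only; otherwise their entries would
    be counted twice.\<close>
  have "nonneg_fact (A' - A) B M r'"
    using nonneg_fact_reindex[OF assms(2), of id "A' - A" id B] by auto
  from ext[OF assms(1)] ext[OF this] have
    "nonneg_fact (A \<union> A') B (\<lambda>a b. if a \<in> A then M a b else 0) r"
    "nonneg_fact (A \<union> A') B (\<lambda>a b. if a \<in> A' - A then M a b else 0) r'"
    by simp_all
  then show ?thesis by (rule nonneg_fact_add) auto
qed

lemma nonneg_fact_Un_right:
  assumes "nonneg_fact A B M r" "nonneg_fact A B' M r'"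
  shows "nonneg_fact A (B \<union> B') M (r + r')"
  using nonneg_fact_transpose[OF nonneg_fact_Un_left[OF assms[THEN nonneg_fact_transpose]]]
  by simp

lemma nonneg_fact_UN_left:
  assumes "finite I" "\<And>i. i \<in> I \<Longrightarrow> nonneg_fact (A i) B M r"
  shows "nonneg_fact (\<Union>i\<in>I. A i) B M (card I * r)"
  using assms
proof (induction I rule: finite_induct)
  case empty
  show ?case using nonneg_fact_zero[of "{}" B M] by simp
next
  case (insert i I)
  then show ?case
    using nonneg_fact_Un_left[of "A i" B M r "\<Union>i\<in>I. A i" "card I * r"] by simp
qed

lemma nonneg_fact_UN_right:
  assumes "finite I" "\<And>i. i \<in> I \<Longrightarrow> nonneg_fact A (B i) M r"
  shows "nonneg_fact A (\<Union>i\<in>I. B i) M (card I * r)"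
  using nonneg_fact_transpose[OF nonneg_fact_UN_left[OF assms(1) nonneg_fact_transpose[OF assms(2)]]]
  by simp

subsection \<open>Slack matrices of independence systems of small rank\<close>

text \<open>The bound from the protocol for \<open>card W < 2 ^ Suc a\<close>, \<open>card W \<le> n\<close> and \<open>d \<le> k\<close>: in the last
  equation the first summand counts the announcements of a set, the other two the restart with \<open>d - 1\<close>.\<close>

fun slack_rank :: "nat \<Rightarrow> nat \<Rightarrow> nat \<Rightarrow> nat" where
  "slack_rank n 0 k = 2"
| "slack_rank n (Suc a) 0 = 0"
| "slack_rank n (Suc a) (Suc k) = n ^ Suc k * slack_rank n a (Suc k) + 1 + slack_rank n (Suc a) k"

text \<open>Intersecting with \<open>W\<close> lets \<open>c\<close> and \<open>S\<close> stay
  unchanged while the protocol shrinks \<open>W\<close>. The difference is real because natural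
  subtraction truncates.\<close>

definition slack :: "'v set \<Rightarrow> ('v \<Rightarrow> nat) \<times> nat \<Rightarrow> 'v set \<Rightarrow> real" where
  "slack W = (\<lambda>(c, d) S. real d - real (sum c (S \<inter> W)))"

text \<open>A nonempty \<open>T\<close> is the set of letters of a word of length exactly
  \<open>k\<close>: list its elements and pad by repeating one of them.\<close>

lemma card_small_nonempty_subsets_le:
  assumes "finite W" "card W \<le> n"
  shows "card {T. T \<subseteq> W \<and> T \<noteq> {} \<and> card T \<le> k} \<le> n ^ k"
proof -
  have "{T. T \<subseteq> W \<and> T \<noteq> {} \<and> card T \<le> k} \<subseteq> set ` {xs. set xs \<subseteq> W \<and> length xs = k}"
  proof
    fix T assume "T \<in> {T. T \<subseteq> W \<and> T \<noteq> {} \<and> card T \<le> k}"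
    then have T: "T \<subseteq> W" "T \<noteq> {}" "card T \<le> k" by auto
    obtain xs where xs: "set xs = T" "distinct xs"
      using finite_distinct_list finite_subset[OF T(1) assms(1)] by blast
    obtain t where t: "t \<in> T" using T(2) by blast
    let ?ys = "xs @ replicate (k - card T) t"
    have "set ?ys = T" "length ?ys = k"
      using xs t T(3) distinct_card[OF xs(2)] by (auto split: if_splits simp: set_replicate_conv_if)
    then show "T \<in> set ` {xs. set xs \<subseteq> W \<and> length xs = k}"
      using T(1) by (intro image_eqI[of _ _ ?ys]) auto
  qed
  then have "card {T. T \<subseteq> W \<and> T \<noteq> {} \<and> card T \<le> k} \<le> card {xs. set xs \<subseteq> W \<and> length xs = k}"
    using finite_lists_length_eq[OF assms(1)] by (meson card_image_le card_mono finite_imageI le_trans)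
  also have "\<dots> \<le> n ^ k"
    using assms by (simp add: card_lists_length_eq power_mono)
  finally show ?thesis .
qed

text \<open>For \<open>W = {v}\<close> the slack is \<open>d\<close> if \<open>v \<notin> S\<close>
  and \<open>d - c v\<close> otherwise, which makes two rank-one terms.\<close>

lemma slack_nonneg_fact_singleton:
  assumes "finite W" "card W \<le> 1"
    and valid: "\<And>c d S. (c, d) \<in> A \<Longrightarrow> S \<in> B \<Longrightarrow> sum c (S \<inter> W) \<le> d"
  shows "nonneg_fact A B (slack W) 2"
proof (cases "W = {}")
  case True
  have "nonneg_fact A B (slack W) 1"
    by (rule nonneg_factI[where f = "\<lambda>_ (c, d). real d" and g = "\<lambda>_ _. 1"])
      (auto simp: slack_def True)
  then show ?thesis by (rule nonneg_fact_mono) simp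
next
  case False
  then obtain v where v: "W = {v}"
    using assms by (metis card_1_singletonE card_0_eq le_neq_implies_less less_one)
  show ?thesis
  \<comment> \<open>Truncated subtraction keeps the second row factor nonnegative; validity makes it
    exact wherever its column factor is 1.\<close>
  proof (rule nonneg_factI[where f = "\<lambda>l (c, d). if l = 0 then real d else real (d - c v)"
        and g = "\<lambda>l S. if (l = 0) = (v \<in> S) then 0 else 1"])
    fix p S assume pS: "p \<in> A" "S \<in> B"
    obtain c d where p: "p = (c, d)" by (cases p)
    show "slack W p S = (\<Sum>l<(2::nat). (case p of (c, d) \<Rightarrow> if l = 0 then real d else real (d - c v)) *
        (if (l = 0) = (v \<in> S) then 0 else 1))"
      using valid[of c d S] pS by (auto simp: p v slack_def numeral_2_eq_2)
  qed auto
qed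

text \<open>In the main case the matrix splits into the blocks \<open>A' T\<close> times
  \<open>B\<close> (Alice speaks), \<open>A''\<close> times \<open>B' T\<close> (Bob speaks),
  \<open>A''\<close> times \<open>B''\<close> (nobody speaks), and the rows with
  \<open>d = 0\<close>.\<close>

lemma slack_nonneg_fact:
  fixes A :: "(('v \<Rightarrow> nat) \<times> nat) set"
  assumes "finite W" "card W < 2 ^ Suc a" "card W \<le> n"
    and "\<And>c d. (c, d) \<in> A \<Longrightarrow> d \<le> k"
    and "\<And>c d S. (c, d) \<in> A \<Longrightarrow> S \<in> B \<Longrightarrow> sum c (S \<inter> W) \<le> d"
  shows "nonneg_fact A B (slack W) (slack_rank n a k)"
  using assms
proof (induction n a k arbitrary: W A B rule: slack_rank.induct)
  case (1 n k)
  then show ?case by (simp add: slack_nonneg_fact_singleton)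
next
  case (2 n a)
  have "slack W p S = 0" if "p \<in> A" "S \<in> B" for p S
    using that 2(4)[of "fst p" "snd p"] 2(5)[of "fst p" "snd p" S]
    by (auto simp: slack_def simp del: of_nat_sum split: prod.splits)
  then show ?case by (simp add: nonneg_fact_zero)
next
  case (3 n a k)
  note fin = 3(3) and cardW = 3(4) and cardn = 3(5) and d_le = 3(6) and valid = 3(7)
  define r where "r = slack_rank n a (Suc k)"
  define \<T> where "\<T> = {T. T \<subseteq> W \<and> T \<noteq> {} \<and> card T \<le> Suc k}"
  define cl where "cl T = T \<union> {v \<in> W. \<not> (\<exists>S\<in>B. insert v T \<subseteq> S)}" for T
  define small where "small = {T \<in> \<T>. 2 * card (cl T) \<le> card W}"
  define large where "large = {T \<in> \<T>. card W < 2 * card (cl T)}"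
  define A' where "A' T = {p \<in> A. \<forall>v\<in>W. fst p v > 0 \<longrightarrow> v \<in> cl T}" for T
  define B' where "B' T = {S \<in> B. T \<subseteq> S}" for T
  \<comment> \<open>Rows with \<open>d = 0\<close> are set aside: their slack vanishes, and the
    restart with \<open>d - 1\<close> needs \<open>d > 0\<close>.\<close>
  define A'' where "A'' = {p \<in> A. snd p > 0} - (\<Union>T\<in>small. A' T)"
  define B'' where "B'' = B - (\<Union>T\<in>large. B' T)"
  have fin\<T>: "finite \<T>" using fin by (simp add: \<T>_def)
  have fin': "finite small" "finite large" using fin\<T> by (auto simp: small_def large_def)
  have cl_sub: "cl T \<subseteq> W" "finite (cl T)" if "T \<in> \<T>" for T
  proof -
    show "cl T \<subseteq> W" using that by (auto simp: cl_def \<T>_def)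
    then show "finite (cl T)" using fin by (rule finite_subset)
  qed
  have alice: "nonneg_fact (A' T) B (slack W) r" if T: "T \<in> small" for T
  proof -
    have T\<T>: "T \<in> \<T>" and card: "2 * card (cl T) \<le> card W" using T by (auto simp: small_def)
    \<comment> \<open>On these rows \<open>c\<close> vanishes on \<open>W - cl T\<close>, so
      shrinking \<open>W\<close> to \<open>cl T\<close> leaves the slack unchanged.\<close>
    have eq: "sum c (S \<inter> W) = sum c (S \<inter> cl T)" if "(c, d) \<in> A' T" for c d S
      by (rule sum.mono_neutral_right) (use that fin cl_sub[OF T\<T>] in \<open>auto simp: A'_def\<close>)
    have "nonneg_fact (A' T) B (slack (cl T)) r"
      unfolding r_def
    proof (rule 3(1))
      show "sum c (S \<inter> cl T) \<le> d" if "(c, d) \<in> A' T" "S \<in> B" for c d S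
        using that valid[of c d S] eq[OF that(1), of S] by (auto simp: A'_def)
    qed (use cl_sub[OF T\<T>] cardW cardn card d_le in \<open>auto simp: A'_def\<close>)
    then show ?thesis
      by (rule nonneg_fact_reindex[where h = id and k = id]) (auto simp: slack_def eq simp del: of_nat_sum)
  qed
  have bob: "nonneg_fact A (B' T) (slack W) r" if T: "T \<in> large" for T
  proof -
    have T\<T>: "T \<in> \<T>" and card: "card W < 2 * card (cl T)" using T by (auto simp: large_def)
    have TW: "T \<subseteq> W" "finite T" using T\<T> fin finite_subset by (auto simp: \<T>_def)
    \<comment> \<open>The weight of \<open>T\<close> moves to the right-hand side. By
      \<open>leT\<close> the subtraction is exact as soon as some column contains
      \<open>T\<close>.\<close>
    define h where "h = (\<lambda>(c :: 'v \<Rightarrow> nat, d). (c, d - sum c T))"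
    \<comment> \<open>No element of \<open>S \<inter> W\<close> is blocked by \<open>T\<close>, as
      \<open>S\<close> itself contains it together with \<open>T\<close>. Hence \<open>S\<close>
      meets \<open>cl T\<close> exactly in \<open>T\<close>.\<close>
    have eq: "sum c (S \<inter> W) = sum c T + sum c (S \<inter> (W - cl T))" if "S \<in> B' T" for c :: "'v \<Rightarrow> nat" and S
    proof -
      have "S \<inter> W = T \<union> (S \<inter> (W - cl T))" "T \<inter> (S \<inter> (W - cl T)) = {}"
        using that TW by (auto simp: cl_def B'_def)
      then show ?thesis using TW fin by (metis finite_Diff finite_Int sum.union_disjoint)
    qed
    have leT: "sum c T + sum c (S \<inter> (W - cl T)) \<le> d" if "(c, d) \<in> A" "S \<in> B' T" for c d S
      using valid[OF that(1), of S] eq[OF that(2), of c] that(2) by (simp add: B'_def)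
    have "card (W - cl T) < 2 ^ Suc a" "card (W - cl T) \<le> n"
      using card_Diff_subset[OF cl_sub(2,1)[OF T\<T>]] card cardW cardn by auto
    then have "nonneg_fact (h ` A) (B' T) (slack (W - cl T)) r"
      unfolding r_def
    proof (intro 3(1))
      show "sum c (S \<inter> (W - cl T)) \<le> d" if cd: "(c, d) \<in> h ` A" and S: "S \<in> B' T" for c d S
      proof -
        obtain d' where "(c, d') \<in> A" "d = d' - sum c T" using cd by (auto simp: h_def)
        then show ?thesis using leT[of c d' S] S by simp
      qed
      show "d \<le> Suc k" if cd: "(c, d) \<in> h ` A" for c d
        using cd d_le by (fastforce simp: h_def)
    qed (use fin in auto)
    then show ?thesis
    proof (rule nonneg_fact_reindex[where h = h and k = id])
      fix p S assume "p \<in> A" and S: "S \<in> B' T"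
      then show "slack W p S = slack (W - cl T) (h p) (id S)"
        using leT[of "fst p" "snd p" S] by (auto simp: slack_def h_def eq simp del: of_nat_sum split: prod.splits)
    qed auto
  qed
  have rest: "nonneg_fact A'' B'' (slack W) (1 + slack_rank n (Suc a) k)"
  proof -
    have less: "sum c (S \<inter> W) < d" if cd: "(c, d) \<in> A''" and S: "S \<in> B''" for c d S
    proof (rule ccontr)
      assume "\<not> sum c (S \<inter> W) < d"
      with cd S valid[of c d S] have sum: "sum c (S \<inter> W) = d" and "d > 0" and cdA: "(c, d) \<in> A"
        and SB: "S \<in> B"
        by (auto simp: A''_def B''_def)
      define T where "T = {v \<in> S \<inter> W. c v > 0}"
      have finT: "finite T" using fin by (simp add: T_def)
      have sumT: "sum c T = d"
        unfolding sum[symmetric]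
        by (rule sum.mono_neutral_left) (use fin in \<open>auto simp: T_def\<close>)
      \<comment> \<open>Weights on \<open>T\<close> are positive integers, so its size is at most
        its weight \<open>d \<le> Suc k\<close>.\<close>
      have "card T \<le> sum c T"
        using sum_mono[of T "\<lambda>_. 1" c] by (auto simp: T_def)
      moreover have "T \<noteq> {}" using sumT \<open>d > 0\<close> by auto
      moreover have "T \<subseteq> W" by (auto simp: T_def)
      ultimately have T\<T>: "T \<in> \<T>" using sumT d_le[OF cdA] by (simp add: \<T>_def)
      \<comment> \<open>Otherwise some member of \<open>B\<close> contains
        \<open>insert v T\<close>, whose weight exceeds \<open>d\<close>.\<close>
      have "v \<in> cl T" if v: "v \<in> W" "c v > 0" for v
      proof (rule ccontr)
        assume "v \<notin> cl T"
        then obtain S' where S': "S' \<in> B" "insert v T \<subseteq> S'" "v \<notin> T" using v by (auto simp: cl_def)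
        have "sum c (insert v T) \<le> sum c (S' \<inter> W)"
          by (rule sum_mono2) (use S' v fin in \<open>auto simp: T_def\<close>)
        with valid[OF cdA S'(1)] sumT v S'(3) finT show False by simp
      qed
      with cdA have "(c, d) \<in> A' T" by (simp add: A'_def)
      with cd have "T \<notin> small" by (auto simp: A''_def)
      with T\<T> have "T \<in> large" by (auto simp: small_def large_def)
      moreover have "S \<in> B' T" using SB by (auto simp: B'_def T_def)
      ultimately show False using S by (auto simp: B''_def)
    qed
    \<comment> \<open>Slacks in this block are integers and at least 1, so the all-ones matrix, of
      rank one, can be split off.\<close>
    define h where "h = (\<lambda>(c :: 'v \<Rightarrow> nat, d :: nat). (c, d - 1))"
    have "nonneg_fact (h ` A'') B'' (slack W) (slack_rank n (Suc a) k)"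
    proof (rule 3(2))
      show "d \<le> k" if "(c, d) \<in> h ` A''" for c d
        using that d_le by (fastforce simp: h_def A''_def)
      show "sum c (S \<inter> W) \<le> d" if "(c, d) \<in> h ` A''" "S \<in> B''" for c d S
        using that less by (fastforce simp: h_def)
    qed (use fin cardW cardn in auto)
    then have "nonneg_fact A'' B'' (\<lambda>p. slack W (h p)) (slack_rank n (Suc a) k)"
      by (rule nonneg_fact_reindex[where h = h and k = id]) auto
    moreover have "nonneg_fact A'' B'' (\<lambda>_ _. 1) 1"
      by (rule nonneg_factI[where f = "\<lambda>_ _. 1" and g = "\<lambda>_ _. 1"]) auto
    ultimately show ?thesis
      by (intro nonneg_fact_add[where M = "\<lambda>_ _. 1" and M' = "\<lambda>p. slack W (h p)"])
        (auto simp: slack_def h_def A''_def)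
  qed
  have "nonneg_fact A'' (\<Union>T\<in>large. B' T) (slack W) (card large * r)"
    by (rule nonneg_fact_UN_right[OF fin'(2)], rule nonneg_fact_reindex[OF bob, where h = id and k = id])
      (auto simp: A''_def)
  from nonneg_fact_Un_right[OF this rest]
  have "nonneg_fact A'' B (slack W) (card large * r + (1 + slack_rank n (Suc a) k))"
    by (rule nonneg_fact_reindex[where h = id and k = id]) (auto simp: B''_def)
  moreover have "nonneg_fact (\<Union>T\<in>small. A' T) B (slack W) (card small * r)"
    by (rule nonneg_fact_UN_left[OF fin'(1) alice])
  moreover have "nonneg_fact {p \<in> A. snd p = 0} B (slack W) 0"
  proof (rule nonneg_fact_zero)
    fix p S assume "p \<in> {p \<in> A. snd p = 0}" "S \<in> B"
    then show "slack W p S = 0"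
      using valid[of "fst p" "snd p" S]
      by (auto simp: slack_def simp del: of_nat_sum split: prod.splits)
  qed
  ultimately have "nonneg_fact ((\<Union>T\<in>small. A' T) \<union> (A'' \<union> {p \<in> A. snd p = 0})) B (slack W)
      (card small * r + ((card large * r + (1 + slack_rank n (Suc a) k)) + 0))"
    by (intro nonneg_fact_Un_left)
  then have "nonneg_fact A B (slack W) ((card small + card large) * r + 1 + slack_rank n (Suc a) k)"
  proof (rule nonneg_fact_reindex[THEN nonneg_fact_mono, where h1 = id and k1 = id])
    show "id ` A \<subseteq> (\<Union>T\<in>small. A' T) \<union> (A'' \<union> {p \<in> A. snd p = 0})" by (auto simp: A''_def)
  qed (auto simp: algebra_simps)
  \<comment> \<open>Each \<open>T\<close> is either small or large, so Alice and Bob share one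
    budget of \<open>n ^ Suc k\<close> announcements.\<close>
  moreover have "card small + card large \<le> n ^ Suc k"
  proof -
    have "card small + card large = card (small \<union> large)"
      by (rule card_Un_disjoint[symmetric]) (use fin' in \<open>auto simp: small_def large_def\<close>)
    also have "\<dots> \<le> card \<T>"
      by (rule card_mono[OF fin\<T>]) (auto simp: small_def large_def)
    finally show ?thesis
      using card_small_nonempty_subsets_le[OF fin cardn, of "Suc k"] by (simp add: \<T>_def)
  qed
  then have "(card small + card large) * r \<le> n ^ Suc k * r" by (rule mult_right_mono) simp
  ultimately show ?case
    by (elim nonneg_fact_mono) (simp add: r_def)
qed

subsection \<open>The size bound\<close>

text \<open>A geometric sum, exact for \<open>n = 2\<close>. This precision is needed: for
  \<open>n = k = 2\<close> and \<open>a = 1\<close> the final bound \<open>slack_rank_add_le\<close>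
  is an equality.\<close>

lemma slack_rank_one_le:
  assumes "n \<ge> 2"
  shows "slack_rank n 1 k + 4 \<le> 4 * n ^ k + k"
proof (induction k)
  case (Suc k)
  have "4 * n ^ k \<le> 2 * n ^ Suc k" using mult_right_mono[OF assms, of "n ^ k"] by simp
  moreover have "slack_rank n 1 (Suc k) = 2 * n ^ Suc k + 1 + slack_rank n 1 k" by simp
  ultimately show ?case using Suc by linarith
qed simp

lemma slack_rank_le:
  assumes "n \<ge> 2"
  shows "slack_rank n (Suc a) k \<le> 3 * 2 ^ Suc a * n ^ (Suc a * k)"
proof (induction a arbitrary: k)
  case 0
  have "k < n ^ k" using less_le_trans[OF less_exp power_mono[OF assms]] by simp
  with slack_rank_one_le[OF assms, of k] show ?case by simp
next
  case (Suc a)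
  note IH = Suc
  show ?case
  proof (induction k)
    case (Suc k)
    \<comment> \<open>With \<open>u\<close> the constant of the previous level, the recursion gives
      \<open>u * r ^ Suc k + 1 + 2 * u * r ^ k\<close>. As \<open>4 \<le> r\<close>, the last two
      terms are at most \<open>u * r ^ Suc k\<close>, so the constant only doubles.\<close>
    define r where "r = n ^ Suc (Suc a)"
    define u where "u = (3::nat) * 2 ^ Suc a"
    have "2 ^ 2 \<le> n ^ 2" using assms by (rule power_mono) simp
    moreover have "n ^ 2 \<le> r" unfolding r_def using assms by (intro power_increasing) auto
    ultimately have r: "4 \<le> r" by simp
    have u: "1 \<le> u" by (simp add: u_def)
    have r_pow: "r ^ j = n ^ (Suc (Suc a) * j)" for j unfolding r_def by (rule power_mult[symmetric])
    have 1: "1 \<le> u * r ^ k" using u r by simp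
    have "4 * (u * r ^ k) \<le> r * (u * r ^ k)" using r by (rule mult_right_mono) simp
    also have "\<dots> = u * r ^ Suc k" by simp
    finally have 2: "2 * (u * r ^ k) + 1 \<le> u * r ^ Suc k" using 1 by linarith
    have "n ^ Suc k * slack_rank n (Suc a) (Suc k) \<le> n ^ Suc k * (u * n ^ (Suc a * Suc k))"
      unfolding u_def by (rule mult_left_mono[OF IH]) simp
    also have "\<dots> = u * r ^ Suc k" unfolding r_pow by (simp add: power_add mult_ac)
    finally have "slack_rank n (Suc (Suc a)) (Suc k) \<le> u * r ^ Suc k + 1 + 2 * (u * r ^ k)"
      using Suc unfolding slack_rank.simps r_pow by (simp add: u_def)
    also have "\<dots> \<le> 2 * u * r ^ Suc k" using 2 by linarith
    finally show ?case unfolding r_pow by (simp add: u_def)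
  qed simp
qed

text \<open>The extra \<open>n\<close> pays for the constraints \<open>0 \<le> x\<close>. Doubling
  the exponent absorbs all constants.\<close>

lemma slack_rank_add_le:
  assumes "2 \<le> n" "2 \<le> k" "1 \<le> a" "2 ^ a \<le> n"
  shows "slack_rank n a k + n \<le> n ^ (2 * a * k)"
proof (cases "a = 1")
  case True
  define X where "X = n ^ k"
  have "n + k \<le> X"
    unfolding X_def using assms(2)
  proof (induction k rule: dec_induct)
    case base
    have "2 * n \<le> n ^ 2" using assms(1) by (simp add: power2_eq_square)
    with assms(1) show ?case by linarith
  next
    case (step k)
    have "2 * n ^ k \<le> n ^ Suc k" using mult_right_mono[OF assms(1), of "n ^ k"] by simp
    with step assms(1) show ?case by linarith
  qed
  \<comment> \<open>Since \<open>4 \<le> n + k \<le> X\<close>, only \<open>X = 4\<close> escapes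
    the estimate \<open>5 * X \<le> X * X\<close>.\<close>
  have "4 * X + n + k \<le> X * X + 4"
  proof (cases "X = 4")
    case True
    with \<open>n + k \<le> X\<close> show ?thesis by simp
  next
    case False
    with \<open>n + k \<le> X\<close> assms have "5 * X \<le> X * X" by (intro mult_right_mono) auto
    with \<open>n + k \<le> X\<close> show ?thesis by linarith
  qed
  with slack_rank_one_le[OF assms(1), of k] show ?thesis
    unfolding True X_def by (simp add: power_add[symmetric] mult_2)
next
  case False
  then obtain b where b: "a = Suc b" "1 \<le> b" using assms(3) by (cases a) auto
  have "2 * 2 \<le> a * k" using assms b by (intro mult_mono) auto
  then have exp: "3 + a * k \<le> 2 * a * k" by simp
  have "slack_rank n a k + n \<le> 3 * (2 ^ a * n ^ (a * k)) + n * 1"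
    using slack_rank_le[OF assms(1), of b k] unfolding b by simp
  also have "\<dots> \<le> 3 * (n * n ^ (a * k)) + n * n ^ (a * k)"
    using assms by (intro add_mono mult_left_mono mult_right_mono) auto
  also have "\<dots> = (2 * 2) * (n * n ^ (a * k))" by simp
  also have "\<dots> \<le> (n * n) * (n * n ^ (a * k))"
    using mult_mono[OF assms(1,1)] by (intro mult_right_mono) auto
  also have "\<dots> = n ^ (3 + a * k)" by (simp add: power_add power3_eq_cube)
  also have "\<dots> \<le> n ^ (2 * a * k)" using assms exp by (intro power_increasing) auto
  finally show ?thesis .
qed

subsection \<open>Projections of polyhedra\<close>

lemma finite_sandwich:
  fixes L U :: "real set"
  assumes "finite L" "finite U" "\<And>l u. l \<in> L \<Longrightarrow> u \<in> U \<Longrightarrow> l \<le> u"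
  shows "\<exists>z. (\<forall>l\<in>L. l \<le> z) \<and> (\<forall>u\<in>U. z \<le> u)"
proof (cases "L = {}")
  case True
  then show ?thesis using assms(2) by (metis empty_iff finite_has_minimal Min_le)
next
  case False
  then show ?thesis using assms by (intro exI[of _ "Max L"]) auto
qed

text \<open>Fourier-Motzkin elimination, removing the last extra variable in each induction
  step.\<close>

lemma polyhedron_projection:
  fixes C :: "('a::euclidean_space \<times> (nat \<Rightarrow> real) \<times> real) set"
  assumes "finite C"
  shows "polyhedron {x. \<exists>y. \<forall>(a, b, \<beta>)\<in>C. a \<bullet> x + (\<Sum>j<l. b j * y j) \<le> \<beta>}"
  using assms
proof (induction l arbitrary: C)
  case 0
  have "{x. \<exists>y::nat \<Rightarrow> real. \<forall>(a, b, \<beta>)\<in>C. a \<bullet> x + (\<Sum>j<0. b j * y j) \<le> \<beta>} =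
      \<Inter> ((\<lambda>(a, b, \<beta>). {x. a \<bullet> x \<le> \<beta>}) ` C)"
    by auto
  then show ?case
    using 0 by (auto intro!: polyhedron_Inter simp: polyhedron_halfspace_le)
next
  case (Suc l)
  \<comment> \<open>The multipliers \<open>b l\<close> and \<open>- b' l\<close> are positive on
    \<open>Cp \<times> Cm\<close> and cancel the coefficient of \<open>y l\<close>.\<close>
  define comb where "comb = (\<lambda>((a::'a, b, \<beta>::real), (a', b', \<beta>')).
    (b l *\<^sub>R a' - b' l *\<^sub>R a, \<lambda>j. b l * b' j - b' l * b j, b l * \<beta>' - b' l * \<beta>))"
  define C0 where "C0 = {(a, b, \<beta>) \<in> C. b l = 0}"
  define Cp where "Cp = {(a, b, \<beta>) \<in> C. b l > 0}"
  define Cm where "Cm = {(a, b, \<beta>) \<in> C. b l < 0}"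
  define D where "D = C0 \<union> comb ` (Cp \<times> Cm)"
  \<comment> \<open>A constraint \<open>c\<close> now reads \<open>p c * y l \<le> e x y c\<close>,
    where \<open>e\<close> does not depend on \<open>y l\<close>.\<close>
  define e where "e = (\<lambda>x y (a :: 'a, b, \<beta>). \<beta> - a \<bullet> x - (\<Sum>j<l. b j * y j))"
  define p where "p c = fst (snd c) l" for c :: "'a \<times> (nat \<Rightarrow> real) \<times> real"
  have fin: "finite C0" "finite Cp" "finite Cm" using Suc(2) by (auto simp: C0_def Cp_def Cm_def intro: rev_finite_subset)
  have e_comb: "e x y (comb (c, c')) = p c * e x y c' - p c' * e x y c" for x y c c'
    by (cases c; cases c') (simp add: e_def comb_def p_def inner_diff_left algebra_simps
        sum_subtractf sum_distrib_left)
  have sat: "(case c of (a, b, \<beta>) \<Rightarrow> a \<bullet> x + (\<Sum>j<l. b j * y j) \<le> \<beta>) \<longleftrightarrow> 0 \<le> e x y c" for x y c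
    by (cases c) (auto simp: e_def)
  have sat': "(case c of (a, b, \<beta>) \<Rightarrow> a \<bullet> x + (\<Sum>j<Suc l. b j * y j) \<le> \<beta>) \<longleftrightarrow> p c * y l \<le> e x y c" for x y c
    by (cases c) (auto simp: e_def p_def)
  have e_upd: "e x (y(l := z)) c = e x y c" for x y z c
    by (cases c) (simp add: e_def)
  have C_split: "C = C0 \<union> Cp \<union> Cm" and p0: "\<And>c. c \<in> C0 \<Longrightarrow> p c = 0"
    and pp: "\<And>c. c \<in> Cp \<Longrightarrow> p c > 0" and pm: "\<And>c. c \<in> Cm \<Longrightarrow> p c < 0"
    by (auto simp: C0_def Cp_def Cm_def p_def)
  have "(\<exists>y. \<forall>c\<in>C. p c * y l \<le> e x y c) \<longleftrightarrow> (\<exists>y. \<forall>c\<in>D. 0 \<le> e x y c)" for x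
  proof
    assume "\<exists>y. \<forall>c\<in>C. p c * y l \<le> e x y c"
    then obtain y where y: "\<And>c. c \<in> C \<Longrightarrow> p c * y l \<le> e x y c" by blast
    have "0 \<le> p c * e x y c' - p c' * e x y c" if "c \<in> Cp" "c' \<in> Cm" for c c'
    proof -
      have "p c * (p c' * y l) \<le> p c * e x y c'"
        using y[of c'] pp[of c] that C_split by (intro mult_left_mono) auto
      moreover have "p c' * e x y c \<le> p c' * (p c * y l)"
        using y[of c] pm[of c'] that C_split by (intro mult_left_mono_neg) auto
      ultimately show ?thesis by (simp add: mult_ac)
    qed
    moreover have "0 \<le> e x y c" if "c \<in> C0" for c
      using y[of c] p0[OF that] C_split that by simp
    ultimately show "\<exists>y. \<forall>c\<in>D. 0 \<le> e x y c"
      by (intro exI[of _ y]) (auto simp: D_def e_comb)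
  next
    assume "\<exists>y. \<forall>c\<in>D. 0 \<le> e x y c"
    then obtain y where y: "\<And>c. c \<in> D \<Longrightarrow> 0 \<le> e x y c" by blast
    have "e x y c' / p c' \<le> e x y c / p c" if "c \<in> Cp" "c' \<in> Cm" for c c'
    proof -
      have "0 \<le> p c * e x y c' - p c' * e x y c"
        using y[of "comb (c, c')"] that unfolding e_comb by (force simp: D_def)
      then show ?thesis using pp[OF that(1)] pm[OF that(2)] by (simp add: field_simps)
    qed
    then obtain z where z: "\<And>c. c \<in> Cm \<Longrightarrow> e x y c / p c \<le> z" "\<And>c. c \<in> Cp \<Longrightarrow> z \<le> e x y c / p c"
      using finite_sandwich[of "(\<lambda>c. e x y c / p c) ` Cm" "(\<lambda>c. e x y c / p c) ` Cp"] fin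
      by (fastforce simp del: split_paired_All split_paired_Ex)
    have "p c * z \<le> e x y c" if "c \<in> C" for c
      using that z[of c] p0[of c] pp[of c] pm[of c] y[of c]
      by (auto simp: C_split D_def field_simps)
    then show "\<exists>y. \<forall>c\<in>C. p c * y l \<le> e x y c"
      by (intro exI[of _ "y(l := z)"]) (simp add: e_upd)
  qed
  then have "{x. \<exists>y. \<forall>(a, b, \<beta>)\<in>C. a \<bullet> x + (\<Sum>j<Suc l. b j * y j) \<le> \<beta>} =
      {x. \<exists>y. \<forall>(a, b, \<beta>)\<in>D. a \<bullet> x + (\<Sum>j<l. b j * y j) \<le> \<beta>}"
    unfolding sat sat' by simp
  then show ?case using Suc(1)[of D] fin by (simp add: D_def)
qed

lemma extended_formulation_polyhedron:
  assumes "extended_formulation l eqs ineqs Q"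
  shows "polyhedron Q"
proof -
  define C where "C = set ineqs \<union> set eqs \<union> (\<lambda>(a, b, \<beta>). (- a, \<lambda>j. - b j, - \<beta>)) ` set eqs"
  have "Q = {x. \<exists>y. \<forall>(a, b, \<beta>)\<in>C. a \<bullet> x + (\<Sum>j<l. b j * y j) \<le> \<beta>}"
  proof -
    have "(\<forall>e\<in>set eqs. satisfies_eq l e x y) \<and> (\<forall>e\<in>set ineqs. satisfies_ineq l e x y) \<longleftrightarrow>
        (\<forall>(a, b, \<beta>)\<in>C. a \<bullet> x + (\<Sum>j<l. b j * y j) \<le> \<beta>)" for x y
    proof -
      have eq: "satisfies_eq l e x y \<longleftrightarrow> satisfies_ineq l e x y \<and>
          satisfies_ineq l ((\<lambda>(a, b, \<beta>). (- a, \<lambda>j. - b j, - \<beta>)) e) x y" for e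
        by (cases e) (auto simp: satisfies_eq_def satisfies_ineq_def sum_negf)
      have "(\<forall>(a, b, \<beta>)\<in>C. a \<bullet> x + (\<Sum>j<l. b j * y j) \<le> \<beta>) \<longleftrightarrow> (\<forall>e\<in>C. satisfies_ineq l e x y)"
        by (auto simp: satisfies_ineq_def)
      then show ?thesis unfolding C_def eq by blast
    qed
    then show ?thesis using assms unfolding extended_formulation_def by simp
  qed
  then show ?thesis using polyhedron_projection[of C l] by (simp add: C_def)
qed

subsection \<open>Gomory closures of down-closed sets\<close>

definition nonneg_down_closed :: "(real ^ 'n) set \<Rightarrow> bool" where
  "nonneg_down_closed R \<longleftrightarrow> (\<forall>x\<in>R. 0 \<le> x \<and> (\<forall>y. 0 \<le> y \<and> y \<le> x \<longrightarrow> y \<in> R))"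

definition pos_part :: "real ^ 'n \<Rightarrow> real ^ 'n" where
  "pos_part c = (\<chi> i. max (c $ i) 0)"

text \<open>Zeroing the coordinates of \<open>x\<close> where \<open>c\<close> is not positive stays
  in \<open>R\<close> and turns \<open>c\<close> into its positive part.\<close>

lemma pos_part_valid:
  assumes "nonneg_down_closed R" "\<And>x. x \<in> R \<Longrightarrow> c \<bullet> x \<le> \<delta>" "x \<in> R"
  shows "pos_part c \<bullet> x \<le> \<delta>"
proof -
  define y where "y = (\<chi> i. if c $ i > 0 then x $ i else 0)"
  have "0 \<le> x" using assms unfolding nonneg_down_closed_def by blast
  then have "0 \<le> y" "y \<le> x" by (auto simp: y_def less_eq_vec_def)
  then have "y \<in> R" using assms(1,3) unfolding nonneg_down_closed_def by blast
  moreover have "c \<bullet> y = pos_part c \<bullet> x"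
    unfolding inner_vec_def by (rule sum.cong) (auto simp: y_def pos_part_def)
  ultimately show ?thesis using assms(2)[of y] by simp
qed

lemma pos_part_integer:
  "c \<in> integer_points \<Longrightarrow> pos_part c \<in> integer_points"
  by (auto simp: integer_points_def pos_part_def max_def)

lemma inner_le_pos_part_inner:
  assumes "0 \<le> x"
  shows "c \<bullet> x \<le> pos_part c \<bullet> x"
  unfolding inner_vec_def
  using assms by (intro sum_mono) (auto simp: pos_part_def less_eq_vec_def intro!: mult_right_mono)

lemma pos_part_inner_mono:
  assumes "y \<le> x"
  shows "pos_part c \<bullet> y \<le> pos_part c \<bullet> x"
  unfolding inner_vec_def
  using assms by (intro sum_mono) (auto simp: pos_part_def less_eq_vec_def intro!: mult_left_mono)

lemma gomory_closureI:
  assumes "x \<in> R"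
    and "\<And>c \<delta>. c \<in> integer_points \<Longrightarrow> \<forall>x\<in>R. c \<bullet> x \<le> \<delta> \<Longrightarrow> c \<bullet> x \<le> of_int \<lfloor>\<delta>\<rfloor>"
  shows "x \<in> gomory_closure R"
  unfolding gomory_closure_def
proof (intro IntI InterI)
  fix H assume "H \<in> {{x. c \<bullet> x \<le> of_int \<lfloor>\<delta>\<rfloor>} | c \<delta>.
      c \<in> integer_points \<and> (\<forall>x\<in>R. c \<bullet> x \<le> \<delta>)}"
  then obtain c \<delta> where "H = {x. c \<bullet> x \<le> of_int \<lfloor>\<delta>\<rfloor>}" "c \<in> integer_points" "\<forall>x\<in>R. c \<bullet> x \<le> \<delta>"
    by blast
  then show "x \<in> H" using assms(2)[of c \<delta>] by simp
qed (fact assms(1))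

lemma gomory_closure_subset: "gomory_closure R \<subseteq> R"
  unfolding gomory_closure_def by (rule Int_lower1)

lemma gomory_closureD:
  assumes "x \<in> gomory_closure R" "c \<in> integer_points" "\<And>x. x \<in> R \<Longrightarrow> c \<bullet> x \<le> \<delta>"
  shows "c \<bullet> x \<le> of_int \<lfloor>\<delta>\<rfloor>"
proof -
  have "{x. c \<bullet> x \<le> of_int \<lfloor>\<delta>\<rfloor>} \<in> {{x. c \<bullet> x \<le> of_int \<lfloor>\<delta>\<rfloor>} | c \<delta>.
      c \<in> integer_points \<and> (\<forall>x\<in>R. c \<bullet> x \<le> \<delta>)}"
    using assms(2,3) by blast
  from InterD[OF IntD2[OF assms(1)[unfolded gomory_closure_def]] this] show ?thesis by simp
qed

text \<open>On nonnegative vectors a cut follows from the one for \<open>pos_part c\<close>, which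
  is also a Gomory cut and is monotone.\<close>

lemma gomory_closure_nonneg_down_closed:
  assumes "nonneg_down_closed R"
  shows "nonneg_down_closed (gomory_closure R)"
proof -
  have "y \<in> gomory_closure R" if x: "x \<in> gomory_closure R" and y: "0 \<le> y" "y \<le> x" for x y
  proof -
    have "x \<in> R" using x gomory_closure_subset by blast
    then have "y \<in> R" using assms y unfolding nonneg_down_closed_def by blast
    moreover have "c \<bullet> y \<le> of_int \<lfloor>\<delta>\<rfloor>"
      if c: "c \<in> integer_points" "\<forall>x\<in>R. c \<bullet> x \<le> \<delta>" for c \<delta>
    proof -
      have "c \<bullet> y \<le> pos_part c \<bullet> x"
        using inner_le_pos_part_inner[OF y(1)] pos_part_inner_mono[OF y(2)] by (rule order_trans)
      also have "\<dots> \<le> of_int \<lfloor>\<delta>\<rfloor>"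
        using c(2) by (intro gomory_closureD[OF x pos_part_integer[OF c(1)]] pos_part_valid[OF assms]) auto
      finally show ?thesis .
    qed
    ultimately show ?thesis by (rule gomory_closureI)
  qed
  moreover have "0 \<le> x" if "x \<in> gomory_closure R" for x
    using assms that gomory_closure_subset unfolding nonneg_down_closed_def by blast
  ultimately show ?thesis unfolding nonneg_down_closed_def by blast
qed

lemma integer_points_subset_gomory_closure:
  "R \<inter> integer_points \<subseteq> gomory_closure R"
proof
  fix z assume z: "z \<in> R \<inter> integer_points"
  have "c \<bullet> z \<le> of_int \<lfloor>\<delta>\<rfloor>" if c: "c \<in> integer_points" "\<forall>x\<in>R. c \<bullet> x \<le> \<delta>" for c \<delta>
  proof -
    have "c \<bullet> z \<in> \<int>" unfolding inner_vec_def
      using c z by (intro Ints_sum) (auto simp: integer_points_def)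
    then obtain w where "c \<bullet> z = of_int w" by (elim Ints_cases)
    moreover have "c \<bullet> z \<le> \<delta>" using c z by blast
    ultimately show ?thesis by (simp add: le_floor_iff)
  qed
  then show "z \<in> gomory_closure R" using z by (intro gomory_closureI) auto
qed

lemma gomory_iterate_approx:
  fixes P Q :: "(real ^ 'n) set"
  assumes P: "nonneg_down_closed P" "0 \<in> P" and QP: "Q \<subseteq> P" and eps: "\<epsilon> > 0"
    and cuts: "\<And>(c :: 'n \<Rightarrow> nat) (D :: nat) x. real D < 1 / \<epsilon> \<Longrightarrow>
        (\<And>z. z \<in> P \<inter> integer_points \<Longrightarrow> (\<Sum>i\<in>UNIV. real (c i) * z $ i) \<le> real D) \<Longrightarrow>
        x \<in> Q \<Longrightarrow> (\<Sum>i\<in>UNIV. real (c i) * x $ i) \<le> real D"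
    and x: "x \<in> Q"
  shows "(1 / (1 + \<epsilon>) ^ t) *\<^sub>R x \<in> (gomory_closure ^^ t) P"
proof -
  have x0: "0 \<le> x" using x QP P unfolding nonneg_down_closed_def by blast
  have inv: "nonneg_down_closed ((gomory_closure ^^ t) P)" "P \<inter> integer_points \<subseteq> (gomory_closure ^^ t) P" for t
  proof (induction t)
    case (Suc t)
    {
      case 1
      show ?case using Suc by (simp add: gomory_closure_nonneg_down_closed)
    next
      case 2
      show ?case using Suc integer_points_subset_gomory_closure[of "(gomory_closure ^^ t) P"] by auto
    }
  qed (use P in auto)
  show ?thesis
  proof (induction t)
    case 0
    show ?case using x QP by auto
  next
    case (Suc t)
    define R where "R = (gomory_closure ^^ t) P"
    define u where "u = (1 / (1 + \<epsilon>) ^ t) *\<^sub>R x"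
    define u' where "u' = (1 / (1 + \<epsilon>) ^ Suc t) *\<^sub>R x"
    have u'_u: "u' = (1 / (1 + \<epsilon>)) *\<^sub>R u" by (simp add: u_def u'_def)
    have u: "u \<in> R" using Suc by (simp add: u_def R_def)
    have scale: "r *\<^sub>R z \<le> z" "0 \<le> r *\<^sub>R z" if "0 \<le> r" "r \<le> 1" "0 \<le> z" for r and z :: "real ^ 'n"
      using that by (auto simp: less_eq_vec_def mult_left_le_one_le)
    have u0: "0 \<le> u" unfolding u_def using x0 eps by (intro scale) (auto simp: divide_le_eq one_le_power)
    have u': "0 \<le> u'" "u' \<le> u" unfolding u'_u using u0 eps by (auto intro!: scale)
    have u'x: "u' \<le> x" unfolding u'_def
    proof (rule scale(1))
      have "1 \<le> (1 + \<epsilon>) ^ Suc t" using eps by (intro one_le_power) simp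
      then show "1 / (1 + \<epsilon>) ^ Suc t \<le> 1" by simp
    qed (use x0 eps in auto)
    have "0 \<in> P \<inter> integer_points" using P by (simp add: integer_points_def)
    then have R0: "0 \<in> R" using inv(2) unfolding R_def by blast
    have "u' \<in> R" using inv(1)[of t] u u' unfolding R_def nonneg_down_closed_def by blast
    moreover have "c \<bullet> u' \<le> of_int \<lfloor>\<delta>\<rfloor>"
      if c: "c \<in> integer_points" "\<forall>x\<in>R. c \<bullet> x \<le> \<delta>" for c \<delta>
    proof -
      have pv: "pos_part c \<bullet> z \<le> \<delta>" if "z \<in> R" for z
        using pos_part_valid[of R c \<delta> z] inv(1)[of t] c that by (auto simp: R_def)
      \<comment> \<open>Nothing is lost by \<open>nat\<close>, as \<open>0 \<in> R\<close> forces
        \<open>0 \<le> \<delta>\<close>.\<close>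
      define D where "D = nat \<lfloor>\<delta>\<rfloor>"
      have "0 \<le> \<delta>" using c R0 by fastforce
      then have D: "real D = of_int \<lfloor>\<delta>\<rfloor>" "\<delta> < real D + 1" by (simp_all add: D_def)
      have "pos_part c \<bullet> u' \<le> real D"
      proof (cases "real D < 1 / \<epsilon>")
        case True
        define c' where "c' i = nat \<lfloor>pos_part c $ i\<rfloor>" for i
        have c': "real (c' i) = pos_part c $ i" for i
        proof -
          have "pos_part c $ i \<in> \<int>" "0 \<le> pos_part c $ i"
            using pos_part_integer[OF c(1)] by (auto simp: integer_points_def pos_part_def)
          then show ?thesis by (auto simp: c'_def elim!: Ints_cases)
        qed
        have inner: "pos_part c \<bullet> z = (\<Sum>i\<in>UNIV. real (c' i) * z $ i)" for z
          by (simp add: inner_vec_def c')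
        have "(\<Sum>i\<in>UNIV. real (c' i) * z $ i) \<le> real D" if z: "z \<in> P \<inter> integer_points" for z
        proof -
          have "z \<in> gomory_closure R" using inv(2)[of "Suc t"] z by (auto simp: R_def)
          then show ?thesis
            unfolding inner[symmetric] D by (rule gomory_closureD[OF _ pos_part_integer[OF c(1)] pv])
        qed
        \<comment> \<open>The cut holds already for the unscaled \<open>x\<close>, and
          \<open>u' \<le> x\<close> carries it over.\<close>
        from cuts[OF True this x] have "pos_part c \<bullet> x \<le> real D" by (simp add: inner)
        then show ?thesis using pos_part_inner_mono[OF u'x, of c] by linarith
      next
        case False
        \<comment> \<open>Rounding loses less than 1, hence at most \<open>\<epsilon> * D\<close>,
          and the additional division by \<open>1 + \<epsilon>\<close> makes up for it.\<close>
        then have "1 \<le> \<epsilon> * real D" using eps by (simp add: field_simps)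
        then have "\<delta> \<le> (1 + \<epsilon>) * real D" using D(2) by (simp add: algebra_simps)
        then have "pos_part c \<bullet> u \<le> (1 + \<epsilon>) * real D" using pv[OF u] by simp
        then show ?thesis using eps by (simp add: u'_u field_simps)
      qed
      then show ?thesis using inner_le_pos_part_inner[OF u'(1), of c] D by simp
    qed
    ultimately have "u' \<in> gomory_closure R" by (rule gomory_closureI)
    then show ?case by (simp add: R_def u'_def)
  qed
qed

subsection \<open>Relaxations from factorizations\<close>

definition indicator_vec :: "'n set \<Rightarrow> real ^ 'n" where
  "indicator_vec S = (\<chi> i. if i \<in> S then 1 else 0)"

lemma sum_indicator_vec:
  fixes c :: "'n::finite \<Rightarrow> nat"
  shows "(\<Sum>i\<in>UNIV. real (c i) * indicator_vec S $ i) = real (sum c S)"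
proof -
  have "(\<Sum>i\<in>UNIV. real (c i) * indicator_vec S $ i) = (\<Sum>i\<in>S. real (c i) * indicator_vec S $ i)"
    by (rule sum.mono_neutral_right) (auto simp: indicator_vec_def)
  then show ?thesis by (simp add: indicator_vec_def)
qed

lemma integer_point_in_unit_cube:
  assumes "z \<in> integer_points" "z \<in> {0..1}"
  shows "\<exists>S. z = indicator_vec S"
proof -
  have "z $ i = 0 \<or> z $ i = 1" for i
  proof -
    obtain w where w: "z $ i = of_int w" using assms(1) by (auto simp: integer_points_def elim: Ints_cases)
    have "0 \<le> z $ i" "z $ i \<le> 1" using assms(2) by (auto simp: less_eq_vec_def)
    then have "w = 0 \<or> w = 1" unfolding w by auto
    then show ?thesis using w by auto
  qed
  then have "z = indicator_vec {i. z $ i = 1}" by (auto simp: indicator_vec_def vec_eq_iff)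
  then show ?thesis by blast
qed

text \<open>Yannakakis' construction: each slack is equated with
  \<open>\<Sum>l<r. f l (c, d) * y l\<close> for variables \<open>y \<ge> 0\<close>. Equations are
  free, so the size does not depend on the number of constraints in \<open>\<C>\<close>, which need
  only be finite.\<close>

lemma relaxation_from_nonneg_fact:
  fixes A :: "real ^ 'n ^ 'm" and \<C> :: "(('n \<Rightarrow> nat) \<times> nat) set"
  assumes P: "P = {x. 0 \<le> x \<and> A *v x \<le> 1}" "P \<subseteq> {0..1}"
    and fin: "finite \<C>"
    and fact: "nonneg_fact \<C> {S. indicator_vec S \<in> P} (slack UNIV) r"
  shows "\<exists>Q. polyhedron Q \<and> integer_hull P \<subseteq> Q \<and> Q \<subseteq> P \<and>
      has_extended_formulation_of_size Q (CARD('m) + CARD('n) + r) \<and>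
      (\<forall>(c, d)\<in>\<C>. \<forall>x\<in>Q. (\<Sum>i\<in>UNIV. real (c i) * x $ i) \<le> real d)"
proof -
  obtain f g where f: "\<And>l p. l < r \<Longrightarrow> p \<in> \<C> \<Longrightarrow> 0 \<le> f l p"
    and g: "\<And>l S. l < r \<Longrightarrow> indicator_vec S \<in> P \<Longrightarrow> 0 \<le> g l S"
    and fg: "\<And>p S. p \<in> \<C> \<Longrightarrow> indicator_vec S \<in> P \<Longrightarrow> slack UNIV p S = (\<Sum>l<r. f l p * g l S)"
    using fact unfolding nonneg_fact_def by blast
  obtain cs where cs: "set cs = \<C>" using finite_list[OF fin] by blast
  obtain ns :: "'n list" where ns: "set ns = UNIV" "distinct ns"
    using finite_distinct_list[of "UNIV :: 'n set"] by auto
  obtain ms :: "'m list" where ms: "set ms = UNIV" "distinct ms"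
    using finite_distinct_list[of "UNIV :: 'm set"] by auto
  define eqs :: "'n constraint list"
    where "eqs = map (\<lambda>(c, d). (\<chi> i. real (c i), \<lambda>l. f l (c, d), real d)) cs"
  define ineqs :: "'n constraint list"
    where "ineqs = map (\<lambda>j. (A $ j, \<lambda>_. 0, 1)) ms @ map (\<lambda>i. (- axis i 1, \<lambda>_. 0, 0)) ns @
      map (\<lambda>l. (0, \<lambda>j. if j = l then - 1 else 0, 0)) [0..<r]"
  define Q where "Q = {x. \<exists>y. (\<forall>e\<in>set eqs. satisfies_eq r e x y) \<and> (\<forall>e\<in>set ineqs. satisfies_ineq r e x y)}"
  have ef: "extended_formulation r eqs ineqs Q" by (simp add: extended_formulation_def Q_def)
  have "length ms = CARD('m)" "length ns = CARD('n)"
    using ns ms distinct_card by metis+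
  then have "length ineqs = CARD('m) + CARD('n) + r" by (simp add: ineqs_def)
  then have size: "has_extended_formulation_of_size Q (CARD('m) + CARD('n) + r)"
    using ef unfolding has_extended_formulation_of_size_def by blast
  have eqs_iff: "(\<forall>e\<in>set eqs. satisfies_eq r e x y) \<longleftrightarrow>
      (\<forall>(c, d)\<in>\<C>. (\<Sum>i\<in>UNIV. real (c i) * x $ i) + (\<Sum>l<r. f l (c, d) * y l) = real d)" for x y
    by (auto simp: eqs_def cs satisfies_eq_def inner_vec_def)
  have "(\<Sum>j<r. (if j = l then - 1 else 0) * y j) = - y l" if "l < r" for l and y :: "nat \<Rightarrow> real"
  proof -
    have "(\<Sum>j<r. (if j = l then - 1 else 0) * y j) = (\<Sum>j<r. if l = j then - y j else 0)"
      by (rule sum.cong) auto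
    then show ?thesis using that by simp
  qed
  then have ineqs_iff: "(\<forall>e\<in>set ineqs. satisfies_ineq r e x y) \<longleftrightarrow> x \<in> P \<and> (\<forall>l<r. 0 \<le> y l)" for x y
    by (auto simp: ineqs_def ns ms satisfies_ineq_def P(1) less_eq_vec_def matrix_vector_mul_component
        inner_axis' ball_Un)
  have Q_iff: "x \<in> Q \<longleftrightarrow> (\<exists>y. (\<forall>(c, d)\<in>\<C>. (\<Sum>i\<in>UNIV. real (c i) * x $ i) +
      (\<Sum>l<r. f l (c, d) * y l) = real d) \<and> x \<in> P \<and> (\<forall>l<r. 0 \<le> y l))" for x
    unfolding Q_def eqs_iff ineqs_iff by simp
  have "polyhedron Q" using ef by (rule extended_formulation_polyhedron)
  moreover have "Q \<subseteq> P" using Q_iff by blast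
  moreover have "integer_hull P \<subseteq> Q"
    unfolding integer_hull_def
  proof (rule hull_minimal)
    show "convex Q" using \<open>polyhedron Q\<close> by (rule polyhedron_imp_convex)
    show "P \<inter> integer_points \<subseteq> Q"
    proof
      fix z assume z: "z \<in> P \<inter> integer_points"
      then obtain S where S: "z = indicator_vec S" using integer_point_in_unit_cube P(2) by blast
      have "real (sum c S) + (\<Sum>l<r. f l (c, d) * g l S) = real d" if "(c, d) \<in> \<C>" for c d
        using fg[OF that, of S] z S by (simp add: slack_def)
      \<comment> \<open>The column factors of \<open>S\<close> provide the values of the extra
        variables.\<close>
      then show "z \<in> Q" unfolding Q_iff
        using z g[of _ S] by (intro exI[of _ "\<lambda>l. g l S"]) (auto simp: S sum_indicator_vec simp del: of_nat_sum)
    qed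
  qed
  moreover have "\<forall>(c, d)\<in>\<C>. \<forall>x\<in>Q. (\<Sum>i\<in>UNIV. real (c i) * x $ i) \<le> real d"
  proof clarify
    fix c d x assume cd: "(c, d) \<in> \<C>" and "x \<in> Q"
    then obtain y where y: "(\<Sum>i\<in>UNIV. real (c i) * x $ i) + (\<Sum>l<r. f l (c, d) * y l) = real d"
      "\<And>l. l < r \<Longrightarrow> 0 \<le> y l" unfolding Q_iff by blast
    have "0 \<le> (\<Sum>l<r. f l (c, d) * y l)" using f cd y by (intro sum_nonneg mult_nonneg_nonneg) auto
    then show "(\<Sum>i\<in>UNIV. real (c i) * x $ i) \<le> real d" using y by linarith
  qed
  ultimately show ?thesis using size by (intro exI[of _ Q] conjI)
qed

subsection \<open>The relaxation\<close>

theorem theorem3: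
  fixes A :: "real ^ 'n ^ 'm" and P :: "(real ^ 'n) set" and \<epsilon> :: real
  assumes A_nonneg: "\<And>i j. A $ i $ j \<ge> 0"
    and P_eq: "P = {x. 0 \<le> x \<and> A *v x \<le> 1}"
    and P_polytope: "polytope P"
    and P_unit_cube: "P \<subseteq> {0..1}"
    and \<epsilon>: "0 < \<epsilon>" "\<epsilon> < 1 / 2"
  shows "\<exists>Q. polyhedron Q \<and> integer_hull P \<subseteq> Q \<and>
           (\<forall>t::nat. t \<ge> 1 \<longrightarrow>
              Q \<subseteq> (\<lambda>x. (1 + \<epsilon>) ^ t *\<^sub>R x) ` (gomory_closure ^^ t) P) \<and>
           (\<exists>s. has_extended_formulation_of_size Q s \<and>
              real s \<le> real CARD('m) + real CARD('n) powr ((2 / \<epsilon>) * log 2 (real CARD('n))))"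
proof -
  define n where "n = CARD('n)"
  have n1: "1 \<le> n" by (simp add: n_def Suc_leI)
  define k where "k = nat (\<lceil>1 / \<epsilon>\<rceil> - 1)"
  \<comment> \<open>This yields \<open>2 \<le> k\<close>, which \<open>slack_rank_add_le\<close>
    requires.\<close>
  have "2 < 1 / \<epsilon>" using \<epsilon> by (simp add: field_simps)
  then have k: "2 \<le> k" "real k < 1 / \<epsilon>" "\<And>D. real D < 1 / \<epsilon> \<Longrightarrow> D \<le> k"
    unfolding k_def by linarith+
  \<comment> \<open>So \<open>a\<close> is the rounded-down binary logarithm of \<open>n\<close>,
    the number of halvings of the ground set.\<close>
  obtain a where a: "2 ^ a \<le> n" "n < 2 ^ Suc a"
    using ex_power_ivl1[of 2 n] n1 by auto
  define \<C> :: "(('n \<Rightarrow> nat) \<times> nat) set" where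
    "\<C> = {(c, d). d \<le> k \<and> (\<forall>i. c i \<le> k) \<and> (\<forall>S. indicator_vec S \<in> P \<longrightarrow> sum c S \<le> d)}"
  have "\<C> \<subseteq> (PiE UNIV (\<lambda>_. {..k})) \<times> {..k}" by (auto simp: \<C>_def)
  then have fin: "finite \<C>" by (rule finite_subset) (simp add: finite_PiE)
  have down: "nonneg_down_closed P"
    unfolding nonneg_down_closed_def
  proof (intro ballI conjI allI impI)
    fix x y assume x: "x \<in> P" and y: "0 \<le> y \<and> y \<le> x"
    have "A *v y \<le> A *v x"
      unfolding less_eq_vec_def matrix_vector_mult_def
      using y A_nonneg by (auto simp: less_eq_vec_def intro!: sum_mono mult_left_mono)
    then show "y \<in> P" using x y P_eq by auto
  qed (use P_eq in auto)
  have P0: "0 \<in> P" by (simp add: P_eq less_eq_vec_def)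
  \<comment> \<open>By down-closure an infeasible \<open>i\<close> lies in no feasible set, so
    \<open>x $ i \<le> 0\<close> is among the enforced inequalities.\<close>
  have unit: "(\<lambda>j. if j = i then 1 else 0, 0) \<in> \<C>" if i: "indicator_vec {i} \<notin> P" for i
  proof -
    have "i \<notin> S" if S: "indicator_vec S \<in> P" for S
    proof
      assume "i \<in> S"
      then have "0 \<le> (indicator_vec {i} :: real ^ 'n)" "indicator_vec {i} \<le> (indicator_vec S :: real ^ 'n)"
        by (auto simp: indicator_vec_def less_eq_vec_def)
      then show False using down S i unfolding nonneg_down_closed_def by blast
    qed
    then show ?thesis using k by (auto simp: \<C>_def)
  qed
  \<comment> \<open>For \<open>n = 1\<close> the size bound is \<open>m + 1\<close>, which leaves no room for slack variables. There the
    constraints \<open>d = 0\<close> suffice, as \<open>x \<le> 1\<close> holds on \<open>P\<close>.\<close>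
  define \<C>' where "\<C>' = (if n = 1 then {p \<in> \<C>. snd p = 0} else \<C>)"
  define r where "r = (if n = 1 then 0 else slack_rank n a k)"
  have fact: "nonneg_fact \<C>' {S. indicator_vec S \<in> P} (slack UNIV) r"
  proof (cases "n = 1")
    case True
    then show ?thesis
      unfolding \<C>'_def r_def
      by (auto intro!: nonneg_fact_zero simp: \<C>_def slack_def simp del: of_nat_sum sum_eq_0_iff)
  next
    case False
    then show ?thesis
      unfolding \<C>'_def r_def
      using slack_nonneg_fact[of "UNIV :: 'n set" a n \<C> k "{S. indicator_vec S \<in> P}"] a
      by (auto simp: n_def \<C>_def)
  qed
  have fin': "finite \<C>'" using fin by (simp add: \<C>'_def)
  obtain Q where Q: "polyhedron Q" "integer_hull P \<subseteq> Q" "Q \<subseteq> P"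
    and size: "has_extended_formulation_of_size Q (CARD('m) + CARD('n) + r)"
    and Q_valid: "\<forall>(c, d)\<in>\<C>'. \<forall>x\<in>Q. (\<Sum>i\<in>UNIV. real (c i) * x $ i) \<le> real d"
    using relaxation_from_nonneg_fact[OF P_eq P_unit_cube fin' fact] by (elim exE conjE)
  have valid: "(\<Sum>i\<in>UNIV. real (c i) * x $ i) \<le> real d" if "(c, d) \<in> \<C>'" "x \<in> Q" for c d x
    using Q_valid that by auto
  have bounds: "0 \<le> x $ i" "x $ i \<le> 1" if "x \<in> Q" for x i
  proof -
    have "x \<in> {0..1}" using that Q(3) P_unit_cube by blast
    then show "0 \<le> x $ i" "x $ i \<le> 1" by (auto simp: less_eq_vec_def)
  qed
  have zero: "x $ i = 0" if "indicator_vec {i} \<notin> P" "x \<in> Q" for x i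
  proof -
    have "(\<lambda>j. if j = i then 1 else 0, 0) \<in> \<C>'" using unit[OF that(1)] by (simp add: \<C>'_def)
    note valid[OF this that(2)]
    also have "(\<Sum>j\<in>UNIV. real (if j = i then 1 else 0) * x $ j) = (\<Sum>j\<in>UNIV. if j = i then x $ j else 0)"
      by (rule sum.cong) auto
    finally have "x $ i \<le> 0" by simp
    then show ?thesis using bounds[OF that(2), of i] by simp
  qed
  have cuts: "(\<Sum>i\<in>UNIV. real (c i) * x $ i) \<le> real D"
    if D: "real D < 1 / \<epsilon>"
      and c: "\<And>z. z \<in> P \<inter> integer_points \<Longrightarrow> (\<Sum>i\<in>UNIV. real (c i) * z $ i) \<le> real D"
      and x: "x \<in> Q" for c :: "'n \<Rightarrow> nat" and D x
  proof -
    \<comment> \<open>\<open>c\<close> is unbounded on infeasible elements, but there \<open>x\<close> vanishes; \<open>\<C>\<close> must be finite.\<close>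
    define c' where "c' i = (if indicator_vec {i} \<in> P then c i else 0)" for i
    have eq: "(\<Sum>i\<in>UNIV. real (c i) * x $ i) = (\<Sum>i\<in>UNIV. real (c' i) * x $ i)"
      by (rule sum.cong) (auto simp: c'_def zero x)
    have cS: "sum c S \<le> D" if "indicator_vec S \<in> P" for S
    proof -
      have "indicator_vec S \<in> P \<inter> integer_points"
        using that by (simp add: integer_points_def indicator_vec_def)
      from c[OF this] show ?thesis unfolding sum_indicator_vec by (simp only: of_nat_le_iff)
    qed
    \<comment> \<open>Either \<open>{i}\<close> is feasible and its own inequality bounds
      \<open>c i\<close>, or \<open>c' i = 0\<close>.\<close>
    have c'D: "c' i \<le> D" for i using cS[of "{i}"] by (simp add: c'_def)
    show ?thesis
    proof (cases "n = 1")
      case True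
      then obtain v :: 'n where v: "UNIV = {v}" unfolding n_def using card_1_singletonE by blast
      have "real (c' v) * x $ v \<le> real (c' v)" using bounds[OF x, of v] by (simp add: mult_left_le)
      then show ?thesis using c'D[of v] unfolding eq by (simp add: v)
    next
      case False
      have "sum c' S \<le> D" if "indicator_vec S \<in> P" for S
      proof -
        have "sum c' S \<le> sum c S" by (rule sum_mono) (simp add: c'_def)
        with cS[OF that] show ?thesis by simp
      qed
      then have "(c', D) \<in> \<C>"
        using k(3)[OF D] c'D by (auto simp: \<C>_def intro: order_trans)
      then show ?thesis unfolding eq using valid x False by (simp add: \<C>'_def)
    qed
  qed
  have "Q \<subseteq> (\<lambda>x. (1 + \<epsilon>) ^ t *\<^sub>R x) ` (gomory_closure ^^ t) P" for t
  proof
    fix x assume "x \<in> Q"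
    then have "(1 / (1 + \<epsilon>) ^ t) *\<^sub>R x \<in> (gomory_closure ^^ t) P"
      by (intro gomory_iterate_approx[OF down P0 Q(3) \<epsilon>(1) cuts])
    moreover have "x = (1 + \<epsilon>) ^ t *\<^sub>R (1 / (1 + \<epsilon>) ^ t) *\<^sub>R x" using \<epsilon> by simp
    ultimately show "x \<in> (\<lambda>x. (1 + \<epsilon>) ^ t *\<^sub>R x) ` (gomory_closure ^^ t) P" by blast
  qed
  moreover have "real (CARD('m) + CARD('n) + r) \<le>
      real CARD('m) + real CARD('n) powr ((2 / \<epsilon>) * log 2 (real CARD('n)))"
  proof (cases "n = 1")
    case True
    then show ?thesis by (simp add: r_def n_def)
  next
    case False
    with n1 have n2: "2 \<le> n" by simp
    have "a \<noteq> 0" using a n2 by (cases a) auto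
    then have "r + n \<le> n ^ (2 * a * k)"
      unfolding r_def using False slack_rank_add_le[OF n2 k(1) _ a(1)] by simp
    then have "real (r + n) \<le> real n powr real (2 * a * k)"
      using n1 by (subst powr_realpow) (simp_all flip: of_nat_power)
    also have "\<dots> \<le> real n powr ((2 / \<epsilon>) * log 2 (real n))"
    proof (rule powr_mono)
      have "real a \<le> log 2 (real n)"
        using a n1 by (simp add: le_log_iff powr_realpow)
      then have "(2 * real k) * real a \<le> (2 / \<epsilon>) * log 2 (real n)"
        using k \<epsilon> by (intro mult_mono) auto
      then show "real (2 * a * k) \<le> (2 / \<epsilon>) * log 2 (real n)" by (simp add: mult_ac)
    qed (use n1 in simp)
    finally show ?thesis by (simp add: n_def)
  qed
  ultimately show ?thesis
    using Q(1,2) size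
    by (intro exI[of _ Q] exI[of _ "CARD('m) + CARD('n) + r"] conjI allI impI)
qed

end
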